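(* Let $(X,\|\cdot\|)$ be a Banach space, let $k\in[0,\infty)$ and $a\in[0,1/2)$, and let $T:X\to X$ be a $(k,a)$-enriched Kannan mapping. Then: (i) $T$ has exactly one fixed point: $Fix(T)=\{p\}$ for some $p\in X$. Moreover, there exists $\lambda\in(0,1]$ such that for every $x_0\in X$ the sequence $\{x_n\}_{n=0}^\infty$ given by $$x_{n+1}=(1-\lambda)x_n+\lambda T x_n,\quad n\ge 0,$$ satisfies: (ii) $\{x_n\}$ converges to $p$ (in norm); (iii) with $\delta=\dfrac{a}{1-a}$, the estimate $$\|x_{n+i-1}-p\|\le \frac{\delta^i}{1-\delta}\,\|x_n-x_{n-1}\|$$ holds for all integers $n\ge 1$ and $i\ge 1$.
   Context: $Fix(T)=\{x\in X: Tx=x\}$ denotes the set of fixed points of $T$. For a normed linear space $(X,\|\cdot\|)$, a mapping $T:X\to X$ is called a $(k,a)$-enriched Kannan mapping, where $k\in[0,\infty)$ and $a\in[0,1/2)$, if $$\|k(x-y)+Tx-Ty\|\le a\left[\|x-Tx\|+\|y-Ty\|\right]\quad\text{for all }x,y\in X.$$ *)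

theory Defs
  imports "HOL-Analysis.Analysis"
begin

definition Fix :: "('a \<Rightarrow> 'a) \<Rightarrow> 'a set" where
  "Fix T = {x. T x = x}"

definition enriched_Kannan :: "real \<Rightarrow> real \<Rightarrow> ('a::real_normed_vector \<Rightarrow> 'a) \<Rightarrow> bool" where
  "enriched_Kannan k a T \<longleftrightarrow>
     0 \<le> k \<and> 0 \<le> a \<and> a < 1/2 \<and>
     (\<forall>x y. norm (k *\<^sub>R (x - y) + T x - T y) \<le> a * (norm (x - T x) + norm (y - T y)))"

end

theory Submission imports Defs begin

text \<open>
  Put \<open>l = 1 / (k + 1)\<close>, so that \<open>1 - l = l * k\<close>. The averaged map
  \<open>S x = (1 - l) x + l T x\<close> then satisfies \<open>S x - S y = l (k (x - y) + T x - T y)\<close> and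
  \<open>x - S x = l (x - T x)\<close>. Hence it has the fixed points of \<open>T\<close>, and multiplying the enriched
  Kannan inequality by \<open>l\<close> shows that it is an ordinary Kannan map:
  \<open>dist (S x) (S y) \<le> a (dist x (S x) + dist y (S y))\<close> (\<open>enriched_Kannan_averaged\<close>). The
  sequence of the theorem is the Picard iteration of \<open>S\<close>, so what remains is Kannan's fixed
  point theorem, proved here in metric spaces.

  For a Kannan map everything is governed by the step lengths
  \<open>d n = dist (x n) (x (Suc n))\<close> of the iteration. Applied to two consecutive iterates, the
  Kannan inequality gives \<open>d (Suc n) \<le> a (d n + d (Suc n))\<close>, so the steps shrink by the
  factor \<open>\<delta> = a / (1 - a) < 1\<close> (\<open>Kannan_step_decay\<close>). Applied to arbitrary iterates, it bounds
  their distance by the steps leading to them; thus the iteration is Cauchy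
  (\<open>Kannan_iteration_Cauchy\<close>), without any summation of a geometric series, and its limit is
  fixed (\<open>Kannan_fixed_point_exists\<close>). Applied to an iterate and a fixed point \<open>p\<close>, it gives
  \<open>dist (x (Suc n)) p \<le> a * d n\<close>, whence convergence and an error estimate with \<open>\<delta> ^ i\<close> in place
  of the weaker \<open>\<delta> ^ i / (1 - \<delta>)\<close> (\<open>Kannan_error_estimate\<close>).
\<close>

locale Kannan_map =
  fixes S :: "'a::metric_space \<Rightarrow> 'a" and a :: real
  assumes a: "0 \<le> a" "a < 1/2"
    and S: "dist (S u) (S v) \<le> a * (dist u (S u) + dist v (S v))"
begin

lemma Kannan_factor_bounds:
  "0 \<le> a / (1 - a)" "a / (1 - a) < 1" "a \<le> a / (1 - a)"
proof -
  show "0 \<le> a / (1 - a)" "a / (1 - a) < 1"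
    using a by (auto simp: field_simps)
  have "a * (1 - a) \<le> a * 1"
    using a by (intro mult_left_mono) auto
  then show "a \<le> a / (1 - a)"
    using a by (simp add: pos_le_divide_eq)
qed

lemma Kannan_fixed_point_unique:
  assumes "S p = p" "S q = q"
  shows "q = p"
  using S[of q p] assms by simp

text \<open>
  A fixed point contributes nothing to the right-hand side of the Kannan inequality, so the
  distance to it is controlled by the last step alone.
\<close>

lemma Kannan_dist_fixed_point:
  assumes "S p = p"
  shows "dist (S u) p \<le> a * dist u (S u)"
  using S[of u p] assms by simp

end

locale Kannan_iteration = Kannan_map S a
  for S :: "'a::metric_space \<Rightarrow> 'a" and a +
  fixes x :: "nat \<Rightarrow> 'a"
  assumes x: "x (Suc n) = S (x n)"
begin

text \<open>
  The step \<open>d (Suc n)\<close> occurs on both sides of the Kannan inequality for \<open>x n\<close> and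
  \<open>x (Suc n)\<close>; solving for it produces the factor \<open>a / (1 - a)\<close>.
\<close>

lemma Kannan_step_decay:
  "dist (x (n + j)) (x (Suc (n + j))) \<le> (a / (1 - a)) ^ j * dist (x n) (x (Suc n))"
proof (induction j)
  case 0
  show ?case by simp
next
  case (Suc j)
  let ?d = "\<lambda>m. dist (x m) (x (Suc m))"
  have "?d (Suc (n + j)) \<le> a * (?d (n + j) + ?d (Suc (n + j)))"
    using S[of "x (n + j)" "x (Suc (n + j))"] by (simp add: x)
  then have "?d (Suc (n + j)) \<le> a / (1 - a) * ?d (n + j)"
    using a by (simp add: field_simps)
  also have "\<dots> \<le> a / (1 - a) * ((a / (1 - a)) ^ j * ?d n)"
    using Suc.IH Kannan_factor_bounds(1) by (rule mult_left_mono)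
  finally show ?case by (simp add: mult.assoc)
qed

lemma Kannan_steps_tendsto_0:
  "(\<lambda>n. dist (x n) (x (Suc n))) \<longlonglongrightarrow> 0"
proof (rule tendsto_sandwich)
  show "\<forall>\<^sub>F n in sequentially. 0 \<le> dist (x n) (x (Suc n))" by simp
  show "\<forall>\<^sub>F n in sequentially.
      dist (x n) (x (Suc n)) \<le> (a / (1 - a)) ^ n * dist (x 0) (x (Suc 0))"
    using Kannan_step_decay[of 0] by simp
  show "(\<lambda>n. (a / (1 - a)) ^ n * dist (x 0) (x (Suc 0))) \<longlonglongrightarrow> 0"
    using a by (intro tendsto_mult_left_zero LIMSEQ_power_zero) (simp add: field_simps)
qed simp

text \<open>
  Two late iterates are images of points moved only slightly by \<open>S\<close>, and the images of such
  points are close by the Kannan inequality.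
\<close>

lemma Kannan_iteration_Cauchy:
  "Cauchy x"
proof (rule metric_CauchyI)
  fix e :: real
  assume e: "0 < e"
  then obtain N where N: "\<And>n. n \<ge> N \<Longrightarrow> dist (x n) (x (Suc n)) < e"
    using order_tendstoD(2)[OF Kannan_steps_tendsto_0 e]
    unfolding eventually_sequentially by blast
  have "dist (x m) (x n) < e" if ge: "m \<ge> Suc N" "n \<ge> Suc N" for m n
  proof -
    obtain m' n' where mn: "m = Suc m'" "n = Suc n'" "m' \<ge> N" "n' \<ge> N"
      using ge by (cases m; cases n) auto
    have "dist (x m) (x n) \<le> a * (dist (x m') (x (Suc m')) + dist (x n') (x (Suc n')))"
      using S[of "x m'" "x n'"] by (simp add: x mn)
    also have "\<dots> \<le> a * (e + e)"
      using N[of m'] N[of n'] mn a by (intro mult_left_mono) auto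
    also have "\<dots> < e"
      using a e by (simp add: field_simps)
    finally show ?thesis .
  qed
  then show "\<exists>M. \<forall>m\<ge>M. \<forall>n\<ge>M. dist (x m) (x n) < e" by blast
qed

lemma Kannan_iteration_converges:
  assumes p: "S p = p"
  shows "x \<longlonglongrightarrow> p"
proof -
  have "(\<lambda>n. dist (x (Suc n)) p) \<longlonglongrightarrow> 0"
  proof (rule tendsto_sandwich)
    show "\<forall>\<^sub>F n in sequentially. 0 \<le> dist (x (Suc n)) p" by simp
    show "\<forall>\<^sub>F n in sequentially. dist (x (Suc n)) p \<le> a * dist (x n) (x (Suc n))"
      using Kannan_dist_fixed_point[OF p] by (simp add: x)
    show "(\<lambda>n. a * dist (x n) (x (Suc n))) \<longlonglongrightarrow> 0"
      by (intro tendsto_mult_right_zero Kannan_steps_tendsto_0)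
  qed simp
  then have "(\<lambda>n. x (Suc n)) \<longlonglongrightarrow> p"
    by (rule iffD2[OF tendsto_dist_iff])
  then show ?thesis by (rule LIMSEQ_imp_Suc)
qed

lemma Kannan_error_estimate:
  assumes p: "S p = p"
  shows "dist (x (Suc (n + j))) p \<le> (a / (1 - a)) ^ Suc j * dist (x n) (x (Suc n))"
proof -
  have "dist (x (Suc (n + j))) p \<le> a * dist (x (n + j)) (x (Suc (n + j)))"
    using Kannan_dist_fixed_point[OF p] by (simp add: x)
  also have "\<dots> \<le> a / (1 - a) * ((a / (1 - a)) ^ j * dist (x n) (x (Suc n)))"
    using Kannan_factor_bounds Kannan_step_decay
    by (intro mult_mono) auto
  finally show ?thesis by (simp add: mult.assoc)
qed

end

text \<open>
  A Kannan map need not be continuous, so the limit \<open>p\<close> of an iteration cannot be shown fixed by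
  passing to the limit in \<open>x (Suc n) = S (x n)\<close>. Passing to the limit in the Kannan inequality
  between \<open>x n\<close> and \<open>p\<close> instead leaves \<open>dist p (S p) \<le> a * dist p (S p)\<close>.
\<close>

lemma Kannan_fixed_point_exists:
  fixes S :: "'a::complete_space \<Rightarrow> 'a"
  assumes "Kannan_map S a"
  shows "\<exists>p. S p = p"
proof -
  \<comment> \<open>Any starting point would do; \<open>undefined\<close> merely names one.\<close>
  define x where "x n = (S ^^ n) undefined" for n
  interpret Kannan_map S a by fact
  interpret Kannan_iteration S a x
    by unfold_locales (simp add: x_def)
  obtain p where p: "x \<longlonglongrightarrow> p"
    using Kannan_iteration_Cauchy Cauchy_convergent convergent_def by blast
  have "dist p (S p) \<le> a * (0 + dist p (S p))"
  proof (rule LIMSEQ_le)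
    show "(\<lambda>n. dist (x (Suc n)) (S p)) \<longlonglongrightarrow> dist p (S p)"
      by (intro tendsto_intros LIMSEQ_Suc p)
    show "(\<lambda>n. a * (dist (x n) (x (Suc n)) + dist p (S p))) \<longlonglongrightarrow> a * (0 + dist p (S p))"
      by (intro tendsto_intros Kannan_steps_tendsto_0)
    show "\<exists>N. \<forall>n\<ge>N. dist (x (Suc n)) (S p) \<le> a * (dist (x n) (x (Suc n)) + dist p (S p))"
      using S by (simp add: x)
  qed
  then have "(1 - a) * dist p (S p) \<le> 0"
    by (simp add: algebra_simps)
  then have "dist p (S p) = 0"
    using a by (simp add: mult_le_0_iff)
  then show ?thesis by (intro exI[of _ p]) simp
qed

text \<open>
  The weight \<open>1 / (k + 1)\<close> is the one for which the averaged map absorbs the term \<open>k (x - y)\<close>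
  of the enriched inequality.
\<close>

lemma enriched_Kannan_averaged:
  fixes T :: "'a::real_normed_vector \<Rightarrow> 'a"
  assumes "enriched_Kannan k a T"
  defines "l \<equiv> 1 / (k + 1)"
  defines "S \<equiv> \<lambda>u. (1 - l) *\<^sub>R u + l *\<^sub>R T u"
  shows "Kannan_map S a"
proof
  show "0 \<le> a" "a < 1/2"
    using assms(1) by (auto simp: enriched_Kannan_def)
next
  fix u v
  have k: "0 \<le> k"
    and T: "norm (k *\<^sub>R (u - v) + T u - T v) \<le> a * (norm (u - T u) + norm (v - T v))"
    using assms(1) by (auto simp: enriched_Kannan_def)
  have l: "0 < l" "1 - l = l * k"
    using k by (auto simp: l_def field_simps)
  have "S u - S v = l *\<^sub>R (k *\<^sub>R (u - v) + T u - T v)"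
    by (simp add: S_def l(2) algebra_simps)
  then have "dist (S u) (S v) = l * norm (k *\<^sub>R (u - v) + T u - T v)"
    using l(1) by (simp add: dist_norm)
  also have "\<dots> \<le> l * (a * (norm (u - T u) + norm (v - T v)))"
    using T l(1) by (intro mult_left_mono) auto
  also have "\<dots> = a * (l * norm (u - T u) + l * norm (v - T v))"
    by (simp add: algebra_simps)
  also have "\<dots> = a * (dist u (S u) + dist v (S v))"
  proof -
    have "w - S w = l *\<^sub>R (w - T w)" for w
      by (simp add: S_def algebra_simps)
    then have "dist w (S w) = l * norm (w - T w)" for w
      using l(1) by (simp add: dist_norm)
    then show ?thesis by simp
  qed
  finally show "dist (S u) (S v) \<le> a * (dist u (S u) + dist v (S v))" .
qed

lemma averaged_fixed_point_iff:
  fixes u v :: "'a::real_vector"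
  assumes "l \<noteq> 0"
  shows "(1 - l) *\<^sub>R u + l *\<^sub>R v = u \<longleftrightarrow> v = u"
proof -
  have "(1 - l) *\<^sub>R u + l *\<^sub>R v = u \<longleftrightarrow> l *\<^sub>R v = l *\<^sub>R u"
    by (auto simp: algebra_simps)
  then show ?thesis using assms by simp
qed

theorem theorem2:
  fixes T :: "'a::banach \<Rightarrow> 'a" and k a :: real
  assumes "0 \<le> k" and "0 \<le> a" and "a < 1/2"
    and "enriched_Kannan k a T"
  shows "\<exists>p. Fix T = {p} \<and>
    (\<exists>l::real. 0 < l \<and> l \<le> 1 \<and>
      (\<forall>x0. \<forall>x :: nat \<Rightarrow> 'a.
        x 0 = x0 \<and> (\<forall>n. x (n + 1) = (1 - l) *\<^sub>R x n + l *\<^sub>R T (x n)) \<longrightarrow>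
          x \<longlonglongrightarrow> p \<and>
          (let \<delta> = a / (1 - a) in
            \<forall>n\<ge>1. \<forall>i\<ge>1.
              norm (x (n + i - 1) - p) \<le> \<delta> ^ i / (1 - \<delta>) * norm (x n - x (n - 1)))))"
proof -
  define l where "l = 1 / (k + 1)"
  define S where "S = (\<lambda>u. (1 - l) *\<^sub>R u + l *\<^sub>R T u)"
  define \<delta> where "\<delta> = a / (1 - a)"
  have l: "0 < l" "l \<le> 1"
    using assms(1) by (auto simp: l_def)
  interpret Kannan_map S a
    unfolding S_def l_def by (rule enriched_Kannan_averaged[OF assms(4)])
  have \<delta>: "0 \<le> \<delta>" "\<delta> < 1"
    using Kannan_factor_bounds by (auto simp: \<delta>_def)
  have S_fixed: "S u = u \<longleftrightarrow> T u = u" for u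
    using l(1) by (simp add: S_def averaged_fixed_point_iff)
  obtain p where p: "S p = p"
    using Kannan_fixed_point_exists[OF Kannan_map_axioms] by blast
  have "Fix T = {p}"
    using Kannan_fixed_point_unique[OF p] p unfolding Fix_def S_fixed by blast
  moreover have "x \<longlonglongrightarrow> p \<and> (\<forall>n\<ge>1. \<forall>i\<ge>1.
      norm (x (n + i - 1) - p) \<le> \<delta> ^ i / (1 - \<delta>) * norm (x n - x (n - 1)))"
    if "\<forall>n. x (n + 1) = (1 - l) *\<^sub>R x n + l *\<^sub>R T (x n)" for x
  proof (intro conjI allI impI)
    interpret Kannan_iteration S a x
      using that by unfold_locales (simp add: S_def)
    show "x \<longlonglongrightarrow> p"
      by (rule Kannan_iteration_converges[OF p])
    fix n i :: nat
    assume "1 \<le> n" "1 \<le> i"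
    then obtain m j where mj: "n = Suc m" "i = Suc j"
      by (cases n; cases i) auto
    \<comment> \<open>The error bound starts from the step \<open>m = n - 1\<close>, so \<open>n + i - 1\<close> is \<open>i\<close> iterations after \<open>x m\<close>.\<close>
    have "dist (x (Suc (m + j))) p \<le> \<delta> ^ i * dist (x m) (x (Suc m))"
      using Kannan_error_estimate[OF p] by (simp add: \<delta>_def mj)
    also have "\<dots> \<le> \<delta> ^ i / (1 - \<delta>) * dist (x m) (x (Suc m))"
    proof (rule mult_right_mono)
      have "\<delta> ^ i * (1 - \<delta>) \<le> \<delta> ^ i * 1"
        using \<delta> by (intro mult_left_mono) auto
      then show "\<delta> ^ i \<le> \<delta> ^ i / (1 - \<delta>)"
        using \<delta> by (simp add: pos_le_divide_eq)
    qed simp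
    finally show "norm (x (n + i - 1) - p) \<le> \<delta> ^ i / (1 - \<delta>) * norm (x n - x (n - 1))"
      by (simp add: mj dist_norm norm_minus_commute)
  qed
  ultimately show ?thesis
    using l unfolding Let_def \<delta>_def[symmetric]
    by (intro exI[of _ p] exI[of _ l] conjI allI impI) simp_all
qed

end
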